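(* Let $a,k \in \mathbb{N}$ and let $M$ be a connected strong $k$-chromatic-choosable graph. Then $$\frac{(P_\ell(M,k+a-1))^a}{2^{k-1}} \leq f_a(M).$$
   Context: All graphs are finite, simple and nonempty; $\mathbb{N}=\{1,2,\dots\}$. A list assignment $L$ for a graph assigns to each vertex $v$ a set $L(v)$ of colors; a proper $L$-coloring is a proper coloring $c$ with $c(v)\in L(v)$ for all $v$; $G$ is $L$-colorable if one exists. $L$ is a $k$-assignment if $|L(v)|=k$ for all $v$, and is constant if all lists are equal. $\chi_\ell(G)$ is the least $k$ such that $G$ is $L$-colorable for every $k$-assignment $L$. The list color function $P_\ell(G,k)$ is the minimum, over all $k$-assignments $L$ for $G$, of the number of proper $L$-colorings of $G$. A graph $G$ is strong $k$-chromatic-choosable if $\chi(G)=k$ and every $(k-1)$-assignment $L$ for which $G$ is not $L$-colorable is constant. The Cartesian product $G \square H$ has vertex set $V(G)\times V(H)$, with $(u,v)$ adjacent to $(u',v')$ iff either $u=u'$ and $vv'\in E(H)$, or $v=v'$ and $uu'\in E(G)$. $K_{a,b}$ is the complete bipartite graph with parts of sizes $a$ and $b$. $f_a(G)$ denotes the smallest $b\in\mathbb{N}$ such that $\chi_\ell(G \square K_{a,b}) = \chi_\ell(G) + a$. *)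

theory Defs
  imports "Graph_Theory.Digraph_Component" "Graph_Theory.Kuratowski" "HOL-Library.FuncSet"
begin

text \<open>
  A finite simple graph is a \<^const>\<open>pair_graph\<close>: a finite, symmetric, irreflexive arc relation
  \<^const>\<open>parcs\<close> on the vertex set \<^const>\<open>pverts\<close>, an edge \<open>uv\<close> being the pair of arcs
  \<open>(u, v)\<close> and \<open>(v, u)\<close>.  All lists are finite and all graphs are finite, so taking the natural
  numbers as the set of colors is no restriction.
\<close>

definition proper_coloring :: "'a pair_pre_digraph \<Rightarrow> ('a \<Rightarrow> 'c) \<Rightarrow> bool" where
  "proper_coloring G c \<longleftrightarrow> (\<forall>u v. (u, v) \<in> parcs G \<longrightarrow> c u \<noteq> c v)"

definition chromatic_number :: "'a pair_pre_digraph \<Rightarrow> nat" where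
  "chromatic_number G =
    (LEAST k. \<exists>c :: 'a \<Rightarrow> nat. c \<in> pverts G \<rightarrow> {..<k} \<and> proper_coloring G c)"

text \<open>Finiteness is stated separately because \<^const>\<open>card\<close> is \<open>0\<close> on infinite sets and \<open>k = 0\<close> occurs.\<close>

definition k_assignment :: "'a pair_pre_digraph \<Rightarrow> nat \<Rightarrow> ('a \<Rightarrow> 'c set) \<Rightarrow> bool" where
  "k_assignment G k L \<longleftrightarrow> (\<forall>v \<in> pverts G. finite (L v) \<and> card (L v) = k)"

definition constant_assignment :: "'a pair_pre_digraph \<Rightarrow> ('a \<Rightarrow> 'c set) \<Rightarrow> bool" where
  "constant_assignment G L \<longleftrightarrow> (\<forall>u \<in> pverts G. \<forall>v \<in> pverts G. L u = L v)"

text \<open>The extensional function space makes colorings that agree on all vertices equal, so that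
  the cardinality of this set is the number of proper \<open>L\<close>-colorings.\<close>

definition list_colorings :: "'a pair_pre_digraph \<Rightarrow> ('a \<Rightarrow> 'c set) \<Rightarrow> ('a \<Rightarrow> 'c) set" where
  "list_colorings G L = {c \<in> Pi\<^sub>E (pverts G) L. proper_coloring G c}"

definition list_colorable :: "'a pair_pre_digraph \<Rightarrow> ('a \<Rightarrow> 'c set) \<Rightarrow> bool" where
  "list_colorable G L \<longleftrightarrow> list_colorings G L \<noteq> {}"

definition list_chromatic_number :: "'a pair_pre_digraph \<Rightarrow> nat" where
  "list_chromatic_number G =
    (LEAST k. \<forall>L :: 'a \<Rightarrow> nat set. k_assignment G k L \<longrightarrow> list_colorable G L)"

definition list_color_function :: "'a pair_pre_digraph \<Rightarrow> nat \<Rightarrow> nat" where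
  "list_color_function G k =
    (LEAST n. \<exists>L :: 'a \<Rightarrow> nat set. k_assignment G k L \<and> n = card (list_colorings G L))"

definition strong_chromatic_choosable :: "nat \<Rightarrow> 'a pair_pre_digraph \<Rightarrow> bool" where
  "strong_chromatic_choosable k G \<longleftrightarrow>
    chromatic_number G = k \<and>
    (\<forall>L :: 'a \<Rightarrow> nat set. k_assignment G (k - 1) L \<longrightarrow> \<not> list_colorable G L \<longrightarrow>
       constant_assignment G L)"

definition cartesian_product ::
  "'a pair_pre_digraph \<Rightarrow> 'b pair_pre_digraph \<Rightarrow> ('a \<times> 'b) pair_pre_digraph" (infixl \<open>\<box>\<close> 70) where
  "G \<box> H =
    \<lparr>pverts = pverts G \<times> pverts H,
     parcs = {((u, v), (u', v')). (u, v) \<in> pverts G \<times> pverts H \<and> (u', v') \<in> pverts G \<times> pverts H \<and>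
       (u = u' \<and> (v, v') \<in> parcs H \<or> v = v' \<and> (u, u') \<in> parcs G)}\<rparr>"

definition complete_bipartite :: "nat \<Rightarrow> nat \<Rightarrow> (nat + nat) pair_pre_digraph" where
  "complete_bipartite a b =
    \<lparr>pverts = Inl ` {..<a} \<union> Inr ` {..<b},
     parcs = (Inl ` {..<a}) \<times> (Inr ` {..<b}) \<union> (Inr ` {..<b}) \<times> (Inl ` {..<a})\<rparr>"

definition f_number :: "nat \<Rightarrow> 'a pair_pre_digraph \<Rightarrow> nat" where
  "f_number a G =
    (LEAST b. b \<ge> 1 \<and>
       list_chromatic_number (G \<box> complete_bipartite a b) = list_chromatic_number G + a)"

lemma complete_bipartite_is_complete_bipartite_digraph:
  "complete_bipartite_digraph a b (with_proj (complete_bipartite a b))"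
  unfolding complete_bipartite_digraph_pair_def
  by (intro conjI exI[where x = "Inl ` {..<a}"] exI[where x = "Inr ` {..<b}"])
    (auto simp: complete_bipartite_def card_image)

lemma pair_graph_complete_bipartite: "pair_graph (complete_bipartite a b)"
  by (rule pair_graphI_complete_bipartite[OF complete_bipartite_is_complete_bipartite_digraph])

lemma pair_graph_cartesian_product:
  assumes "pair_graph G" "pair_graph H"
  shows "pair_graph (G \<box> H)"
proof -
  interpret G: pair_graph G by fact
  interpret H: pair_graph H by fact
  have "parcs (G \<box> H) \<subseteq> pverts (G \<box> H) \<times> pverts (G \<box> H)"
    by (auto simp: cartesian_product_def)
  moreover have fin: "finite (pverts (G \<box> H))"
    using G.pair_finite_verts H.pair_finite_verts by (simp add: cartesian_product_def)
  ultimately have "finite (parcs (G \<box> H))"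
    by (meson finite_SigmaI finite_subset)
  then show ?thesis
    using fin
    by unfold_locales
      (auto simp: cartesian_product_def symmetric_def sym_def
        dest: G.arcs_symmetric H.arcs_symmetric G.no_loops' H.no_loops')
qed

lemma list_color_function_attained:
  fixes G :: "'a pair_pre_digraph"
  shows "\<exists>L :: 'a \<Rightarrow> nat set. k_assignment G k L \<and> card (list_colorings G L) = list_color_function G k"
proof -
  have "k_assignment G k (\<lambda>_. {..<k})"
    by (simp add: k_assignment_def)
  then have "\<exists>n. \<exists>L :: 'a \<Rightarrow> nat set. k_assignment G k L \<and> n = card (list_colorings G L)"
    by blast
  from LeastI_ex[OF this] show ?thesis
    unfolding list_color_function_def by metis
qed

end

theory Submission
  imports Defs "HOL-Library.Disjoint_Sets"
begin

text \<open>
  Let \<open>L\<close> be a \<open>(k + a - 1)\<close>-assignment for \<open>M \<box> K\<^bsub>a,b\<^esub>\<close> without a proper coloring.  Color the \<open>a\<close>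
  copies of \<open>M\<close> over the first part, in at least \<open>P\<^sub>\<ell>(M, k + a - 1)\<^sup>a\<close> ways.  Each such tuple
  must be bad for one of the \<open>b\<close> other copies, which then keeps lists of size at least \<open>k - 1\<close> but
  has no coloring; strong chromatic-choosability forces all remaining lists to equal a single
  \<open>(k - 1)\<close>-set \<open>A\<close>.  So the tuple uses \<open>a\<close> different colors at every vertex \<open>v\<close>, and hence the \<open>a\<close> lists
  over \<open>v\<close> in the first part are pairwise disjoint.  Consequently the tuple is recovered from \<open>A\<close>, and
  \<open>A\<close> from the colors at one vertex \<open>w\<close>.  If \<open>s\<^sub>i \<ge> 1\<close> colors of the list of \<open>w\<close> in the bad copy lie in
  the \<open>i\<close>-th list over \<open>w\<close>, there are at most \<open>\<Prod>s\<^sub>i \<le> \<Prod>2\<^bsup>s\<^sub>i - 1\<^esup> \<le> 2\<^bsup>k - 1\<^esup>\<close> such choices.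

  The number \<open>f\<^sub>a(G)\<close> is defined by a least element, so one also needs that some \<open>b\<close> attains
  \<open>\<chi>\<^sub>\<ell>(G) + a\<close>: use pairwise disjoint constant lists on the first part and, for each tuple of colorings,
  a copy whose lists are the colors of the tuple together with a fixed \<open>(\<chi>\<^sub>\<ell>(G) - 1)\<close>-assignment in
  new colors that admits no coloring.
\<close>

section \<open>Finite sets\<close>

lemma injective_choice_exists:
  assumes "finite V" and "\<And>v. v \<in> V \<Longrightarrow> card V \<le> card (L v)"
  shows "\<exists>c. inj_on c V \<and> (\<forall>v\<in>V. c v \<in> L v)"
  using assms
proof (induction V)
  case empty
  then show ?case by simp
next
  case (insert x V)
  have "card V \<le> card (L v)" if "v \<in> V" for v
    using insert.hyps insert.prems[of v] that by simp
  then obtain c where c: "inj_on c V" "\<forall>v\<in>V. c v \<in> L v"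
    using insert.IH by blast
  have "card (c ` V) < card (L x)"
    using card_image_le[OF insert.hyps(1), of c] insert.hyps insert.prems[of x] by simp
  then obtain y where "y \<in> L x" "y \<notin> c ` V"
    using card_mono[OF finite_imageI[OF insert.hyps(1)], of "L x" c] by force
  with c insert.hyps(2) have "inj_on (c(x := y)) (insert x V) \<and> (\<forall>v\<in>insert x V. (c(x := y)) v \<in> L v)"
    by (auto simp: inj_on_def)
  then show ?case by blast
qed

lemma inj_on_and_image_subset_if_card_Diff_le:
  assumes "finite S" "finite I" and "card (S - f ` I) + card I \<le> card S"
  shows "inj_on f I" and "f ` I \<subseteq> S"
proof -
  have "card I \<le> card (S \<inter> f ` I)"
    using card_Int_Diff[OF assms(1), of "f ` I"] assms(3) by simp
  moreover have "card (S \<inter> f ` I) \<le> card (f ` I)"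
    using assms(2) by (intro card_mono) auto
  moreover have "card (f ` I) \<le> card I"
    using assms(2) by (rule card_image_le)
  ultimately have "card (f ` I) = card I" and "card (S \<inter> f ` I) = card (f ` I)"
    by linarith+
  then show "inj_on f I" and "f ` I \<subseteq> S"
    using assms(2) card_subset_eq[of "f ` I" "S \<inter> f ` I"] by (auto intro: eq_card_imp_inj_on)
qed

lemma disjoint_family_blocks:
  fixes m :: nat
  shows "disjoint_family (\<lambda>i. {i * m..<Suc i * m})"
proof -
  have "x div m = i" if "x \<in> {i * m..<Suc i * m}" for x i
    using that by (intro div_nat_eqI) (auto simp: mult.commute)
  then show ?thesis
    unfolding disjoint_family_on_def by (metis IntE equals0I)
qed

lemma card_PiE_le_two_power:
  assumes "finite I" "disjoint_family_on S I" and finite_S: "\<And>i. i \<in> I \<Longrightarrow> finite (S i)"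
  shows "card (\<Pi>\<^sub>E i\<in>I. S i) \<le> 2 ^ (card (\<Union>i\<in>I. S i) - card I)"
proof (cases "\<exists>i\<in>I. S i = {}")
  case True
  then have "(\<Pi>\<^sub>E i\<in>I. S i) = {}"
    by (simp add: PiE_eq_empty_iff)
  then show ?thesis by simp
next
  case False
  have "card (S i) \<le> 2 ^ (card (S i) - 1)" for i
    using less_exp[of "card (S i) - 1"] by linarith
  then have "card (\<Pi>\<^sub>E i\<in>I. S i) \<le> (\<Prod>i\<in>I. 2 ^ (card (S i) - 1))"
    unfolding card_PiE[OF \<open>finite I\<close>] by (intro prod_mono) simp
  also have "\<dots> = 2 ^ (\<Sum>i\<in>I. card (S i) - 1)"
    by (simp add: power_sum)
  also have "(\<Sum>i\<in>I. card (S i) - 1) = (\<Sum>i\<in>I. card (S i)) - card I"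
    using False finite_S sum_subtractf_nat[of I "\<lambda>_. 1" "\<lambda>i. card (S i)"]
    by (simp add: Suc_le_eq card_gt_0_iff)
  also have "(\<Sum>i\<in>I. card (S i)) = card (\<Union>i\<in>I. S i)"
    using assms by (simp add: card_UN_disjoint')
  finally show ?thesis .
qed

section \<open>List colorings\<close>

lemma k_assignmentD:
  assumes "k_assignment G n L" "v \<in> pverts G"
  shows "finite (L v)" and "card (L v) = n"
  using assms by (auto simp: k_assignment_def)

lemma k_subassignment_exists:
  assumes "\<And>v. v \<in> pverts G \<Longrightarrow> finite (L v)" and "\<And>v. v \<in> pverts G \<Longrightarrow> n \<le> card (L v)"
  obtains L' where "k_assignment G n L'" "\<And>v. v \<in> pverts G \<Longrightarrow> L' v \<subseteq> L v"
proof -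
  have "\<forall>v\<in>pverts G. \<exists>B. B \<subseteq> L v \<and> finite B \<and> card B = n"
    using assms by (metis obtain_subset_with_card_n)
  then obtain L' where "\<forall>v\<in>pverts G. L' v \<subseteq> L v \<and> finite (L' v) \<and> card (L' v) = n"
    by metis
  then show thesis
    by (intro that[of L']) (auto simp: k_assignment_def)
qed

lemma constant_assignment_if_subassignments_constant:
  assumes fin: "\<And>v. v \<in> pverts G \<Longrightarrow> finite (L v)" and card_ge: "\<And>v. v \<in> pverts G \<Longrightarrow> n \<le> card (L v)"
    and "0 < n" and "1 < card (pverts G)"
    and sub_const: "\<And>B. k_assignment G n B \<Longrightarrow> (\<And>v. v \<in> pverts G \<Longrightarrow> B v \<subseteq> L v) \<Longrightarrow> constant_assignment G B"
  shows "k_assignment G n L" and "constant_assignment G L"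
proof -
  obtain B where B: "k_assignment G n B" and B_sub: "\<And>v. v \<in> pverts G \<Longrightarrow> B v \<subseteq> L v"
    using k_subassignment_exists[of G L n] fin card_ge by blast
  have "L v = B v" if v: "v \<in> pverts G" for v
  proof (rule ccontr)
    assume "L v \<noteq> B v"
    then obtain x where x: "x \<in> L v" "x \<notin> B v"
      using B_sub[OF v] by blast
    obtain y where y: "y \<in> B v"
      using k_assignmentD[OF B v] \<open>0 < n\<close> by fastforce
    obtain u where u: "u \<in> pverts G" "u \<noteq> v"
      using \<open>1 < card (pverts G)\<close> card_mono[of "{v}" "pverts G"] by force
    define C where "C = B(v := insert x (B v - {y}))"
    have "card (insert x (B v - {y})) = n"
      using k_assignmentD[OF B v] x y \<open>0 < n\<close> by (simp add: card_insert_if)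
    then have "constant_assignment G C"
      using B B_sub x(1) v by (intro sub_const) (auto simp: C_def k_assignment_def)
    moreover have "constant_assignment G B"
      by (rule sub_const[OF B B_sub])
    ultimately have "C v = C u" and "B v = B u"
      using u(1) v unfolding constant_assignment_def by blast+
    with u(2) x(2) show False
      by (auto simp: C_def)
  qed
  with B show "k_assignment G n L"
    by (simp add: k_assignment_def)
  then show "constant_assignment G L"
    by (rule sub_const) simp
qed

lemma list_color_function_le:
  fixes L :: "'a \<Rightarrow> nat set"
  assumes "k_assignment G n L"
  shows "list_color_function G n \<le> card (list_colorings G L)"
  unfolding list_color_function_def using assms by (intro Least_le) blast

context pair_graph
begin

lemma proper_coloring_if_inj_on:
  assumes "inj_on c (pverts G)"
  shows "proper_coloring G c"
  using assms by (auto simp: proper_coloring_def inj_on_def dest: in_arcsD1 in_arcsD2 no_loops')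

lemma proper_coloring_restrict: "proper_coloring G (restrict c (pverts G)) \<longleftrightarrow> proper_coloring G c"
  by (auto simp: proper_coloring_def dest: in_arcsD1 in_arcsD2)

lemma list_colorableI:
  assumes "\<And>v. v \<in> pverts G \<Longrightarrow> c v \<in> L v" and "proper_coloring G c"
  shows "list_colorable G L"
proof -
  have "restrict c (pverts G) \<in> list_colorings G L"
    using assms by (simp add: list_colorings_def proper_coloring_restrict)
  then show ?thesis
    by (auto simp: list_colorable_def)
qed

lemma list_colorable_iff:
  "list_colorable G L \<longleftrightarrow> (\<exists>c. (\<forall>v\<in>pverts G. c v \<in> L v) \<and> proper_coloring G c)"
proof
  assume "list_colorable G L"
  then show "\<exists>c. (\<forall>v\<in>pverts G. c v \<in> L v) \<and> proper_coloring G c"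
    by (auto simp: list_colorable_def list_colorings_def)
qed (blast intro: list_colorableI)

lemma list_colorable_mono:
  assumes "list_colorable G L" and "\<And>v. v \<in> pverts G \<Longrightarrow> L v \<subseteq> L' v"
  shows "list_colorable G L'"
  using assms unfolding list_colorable_iff by blast

lemma list_colorable_imageD:
  assumes "list_colorable G (\<lambda>v. f ` L v)"
  shows "list_colorable G L"
proof -
  obtain c where c: "\<forall>v\<in>pverts G. c v \<in> f ` L v" "proper_coloring G c"
    using assms unfolding list_colorable_iff by blast
  then have "\<forall>v\<in>pverts G. \<exists>x. x \<in> L v \<and> c v = f x"
    by blast
  then obtain d where d: "\<forall>v\<in>pverts G. d v \<in> L v \<and> c v = f (d v)"
    by metis
  have "proper_coloring G d"
    using c(2) d unfolding proper_coloring_def by (metis in_arcsD1 in_arcsD2)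
  with d show ?thesis
    unfolding list_colorable_iff by blast
qed

lemma finite_list_colorings:
  assumes "\<And>v. v \<in> pverts G \<Longrightarrow> finite (L v)"
  shows "finite (list_colorings G L)"
proof (rule finite_subset)
  show "list_colorings G L \<subseteq> Pi\<^sub>E (pverts G) L"
    by (auto simp: list_colorings_def)
  show "finite (Pi\<^sub>E (pverts G) L)"
    using assms pair_finite_verts by (intro finite_PiE)
qed

text \<open>Since \<open>x\<close> is deleted from all other lists, \<open>v\<close> can be recolored with \<open>x\<close>, whatever color of
  \<open>B\<close> it had.\<close>

lemma list_coloring_by_recoloring:
  assumes v: "v \<in> pverts G" and x: "x \<in> L v" and "list_colorable G ((\<lambda>u. L u - {x})(v := B))"
  shows "\<exists>c\<in>list_colorings G L. c v = x"
proof -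
  obtain d where d: "\<forall>u\<in>pverts G. d u \<in> ((\<lambda>u. L u - {x})(v := B)) u" "proper_coloring G d"
    using assms(3) unfolding list_colorable_iff by blast
  then have other: "d u \<in> L u \<and> d u \<noteq> x" if "u \<in> pverts G" "u \<noteq> v" for u
    using that by auto
  have "proper_coloring G (d(v := x))"
    unfolding proper_coloring_def
  proof (intro allI impI)
    fix u w assume "(u, w) \<in> parcs G"
    then have "u \<in> pverts G" "w \<in> pverts G" "u \<noteq> w" "d u \<noteq> d w"
      using d(2) by (auto simp: proper_coloring_def dest: in_arcsD1 in_arcsD2 no_loops')
    then show "(d(v := x)) u \<noteq> (d(v := x)) w"
      using other by auto
  qed
  then have "restrict (d(v := x)) (pverts G) \<in> list_colorings G L"
    using other x by (auto simp: list_colorings_def proper_coloring_restrict)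
  then show ?thesis
    by (rule rev_bexI) (simp add: v)
qed

lemma list_colorable_if_card_verts_le:
  assumes "\<And>v. v \<in> pverts G \<Longrightarrow> card (pverts G) \<le> card (L v)"
  shows "list_colorable G L"
proof -
  obtain c where "inj_on c (pverts G)" "\<forall>v\<in>pverts G. c v \<in> L v"
    using injective_choice_exists[of "pverts G" L] pair_finite_verts assms by blast
  then show ?thesis
    unfolding list_colorable_iff using proper_coloring_if_inj_on by blast
qed

lemma list_colorable_constant_iff:
  assumes "finite A"
  shows "list_colorable G (\<lambda>_. A) \<longleftrightarrow> chromatic_number G \<le> card A"
proof
  assume "list_colorable G (\<lambda>_. A)"
  moreover obtain h where "bij_betw h {..<card A} A"
    using ex_bij_betw_nat_finite[OF assms] by (auto simp: lessThan_atLeast0)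
  ultimately have "list_colorable G (\<lambda>_. {..<card A})"
    by (intro list_colorable_imageD[where f = h]) (simp add: bij_betw_imp_surj_on)
  then have "\<exists>c. c \<in> pverts G \<rightarrow> {..<card A} \<and> proper_coloring G c"
    by (simp add: list_colorable_iff Pi_iff)
  then show "chromatic_number G \<le> card A"
    unfolding chromatic_number_def by (rule Least_le)
next
  assume le: "chromatic_number G \<le> card A"
  have "list_colorable G (\<lambda>_. {..<card (pverts G)})"
    by (intro list_colorable_if_card_verts_le) simp
  then have "\<exists>c :: 'a \<Rightarrow> nat. c \<in> pverts G \<rightarrow> {..<card (pverts G)} \<and> proper_coloring G c"
    by (simp add: list_colorable_iff Pi_iff)
  then have "\<exists>c :: 'a \<Rightarrow> nat. c \<in> pverts G \<rightarrow> {..<chromatic_number G} \<and> proper_coloring G c"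
    unfolding chromatic_number_def by (rule LeastI)
  then have "list_colorable G (\<lambda>_. {..<chromatic_number G})"
    by (simp add: list_colorable_iff Pi_iff)
  then have "list_colorable G (\<lambda>_. {..<card A})"
    by (rule list_colorable_mono) (use le in simp)
  moreover obtain h where "bij_betw h A {..<card A}"
    using ex_bij_betw_finite_nat[OF assms] by (auto simp: lessThan_atLeast0)
  ultimately show "list_colorable G (\<lambda>_. A)"
    by (intro list_colorable_imageD[where f = h]) (simp add: bij_betw_imp_surj_on)
qed

lemma chromatic_number_le_card_verts: "chromatic_number G \<le> card (pverts G)"
proof -
  have "list_colorable G (\<lambda>_. {..<card (pverts G)})"
    by (intro list_colorable_if_card_verts_le) simp
  then show ?thesis
    by (simp add: list_colorable_constant_iff)
qed

lemma list_colorable_if_list_chromatic_number_le: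
  fixes L :: "'a \<Rightarrow> nat set"
  assumes "\<And>v. v \<in> pverts G \<Longrightarrow> finite (L v)"
    and "\<And>v. v \<in> pverts G \<Longrightarrow> list_chromatic_number G \<le> card (L v)"
  shows "list_colorable G L"
proof -
  have "\<exists>n. \<forall>L :: 'a \<Rightarrow> nat set. k_assignment G n L \<longrightarrow> list_colorable G L"
    by (intro exI[of _ "card (pverts G)"])
      (auto simp: k_assignment_def intro: list_colorable_if_card_verts_le)
  note choosable = LeastI_ex[OF this, folded list_chromatic_number_def, rule_format]
  obtain L' where "k_assignment G (list_chromatic_number G) L'" "\<And>v. v \<in> pverts G \<Longrightarrow> L' v \<subseteq> L v"
    using k_subassignment_exists[of G L] assms by blast
  then show ?thesis
    using choosable list_colorable_mono by blast
qed

lemma list_chromatic_number_le_iff: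
  "list_chromatic_number G \<le> n \<longleftrightarrow> (\<forall>L :: 'a \<Rightarrow> nat set. k_assignment G n L \<longrightarrow> list_colorable G L)"
proof
  assume "\<forall>L :: 'a \<Rightarrow> nat set. k_assignment G n L \<longrightarrow> list_colorable G L"
  then show "list_chromatic_number G \<le> n"
    unfolding list_chromatic_number_def by (rule Least_le)
qed (auto simp: k_assignment_def intro: list_colorable_if_list_chromatic_number_le)

lemma chromatic_number_le_list_chromatic_number: "chromatic_number G \<le> list_chromatic_number G"
proof -
  have "list_colorable G (\<lambda>_. {..<list_chromatic_number G})"
    by (intro list_colorable_if_list_chromatic_number_le) simp_all
  then show ?thesis
    by (simp add: list_colorable_constant_iff)
qed

lemma chromatic_number_pos:
  assumes "pverts G \<noteq> {}"
  shows "0 < chromatic_number G"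
proof (rule ccontr)
  assume "\<not> 0 < chromatic_number G"
  then have "list_colorable G (\<lambda>_. {} :: nat set)"
    by (simp add: list_colorable_constant_iff)
  with assms show False
    unfolding list_colorable_iff by blast
qed

lemma no_arcs_if_chromatic_number_le_1:
  assumes "chromatic_number G \<le> 1"
  shows "parcs G = {}"
proof -
  have "list_colorable G (\<lambda>_. {0 :: nat})"
    using assms by (simp add: list_colorable_constant_iff)
  then obtain c where "\<forall>v\<in>pverts G. c v = (0 :: nat)" "proper_coloring G c"
    unfolding list_colorable_iff by auto
  then show ?thesis
    unfolding proper_coloring_def by (metis equals0I in_arcsD1 in_arcsD2 surj_pair)
qed

lemma connected_no_arcs_imp_single_vertex:
  assumes "Digraph_Component.connected (with_proj G)" "parcs G = {}" "u \<in> pverts G"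
  shows "pverts G = {u}"
proof -
  have "v = u" if "v \<in> pverts G" for v
  proof -
    have "v \<rightarrow>\<^sup>*\<^bsub>mk_symmetric (with_proj G)\<^esub> u"
      using assms(1,3) that by (auto simp: connected_def strongly_connected_def)
    then show ?thesis
      using assms(2) by (cases rule: pre_digraph.converse_reachable_cases) (auto simp: parcs_mk_symmetric)
  qed
  with assms(3) show ?thesis by blast
qed

end

section \<open>Cartesian products with complete bipartite graphs\<close>

lemma proper_coloring_cartesian_product_iff:
  assumes "pair_graph G" "pair_graph H"
  shows "proper_coloring (G \<box> H) c \<longleftrightarrow>
    (\<forall>y\<in>pverts H. proper_coloring G (\<lambda>x. c (x, y))) \<and> (\<forall>x\<in>pverts G. proper_coloring H (\<lambda>y. c (x, y)))"
proof -
  interpret G: pair_graph G by fact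
  interpret H: pair_graph H by fact
  show ?thesis
    by (fastforce simp: proper_coloring_def cartesian_product_def
        dest: G.in_arcsD1 G.in_arcsD2 H.in_arcsD1 H.in_arcsD2)
qed

lemma proper_coloring_complete_bipartite_iff:
  "proper_coloring (complete_bipartite a b) c \<longleftrightarrow> (\<forall>i<a. \<forall>j<b. c (Inl i) \<noteq> c (Inr j))"
  by (fastforce simp: proper_coloring_def complete_bipartite_def)

lemma ball_pverts_cartesian_product:
  "(\<forall>x\<in>pverts (G \<box> H). P x) \<longleftrightarrow> (\<forall>y\<in>pverts H. \<forall>v\<in>pverts G. P (v, y))"
  by (auto simp: cartesian_product_def)

lemma ball_pverts_complete_bipartite:
  "(\<forall>y\<in>pverts (complete_bipartite a b). P y) \<longleftrightarrow> (\<forall>i<a. P (Inl i)) \<and> (\<forall>j<b. P (Inr j))"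
  by (auto simp: complete_bipartite_def)

lemma k_assignment_product_complete_bipartite_iff:
  "k_assignment (G \<box> complete_bipartite a b) n L \<longleftrightarrow>
    (\<forall>i<a. k_assignment G n (\<lambda>v. L (v, Inl i))) \<and> (\<forall>j<b. k_assignment G n (\<lambda>v. L (v, Inr j)))"
  unfolding k_assignment_def ball_pverts_cartesian_product ball_pverts_complete_bipartite ..

definition coloring_tuples ::
  "'a pair_pre_digraph \<Rightarrow> nat \<Rightarrow> (nat \<Rightarrow> 'a \<Rightarrow> 'c set) \<Rightarrow> (nat \<Rightarrow> 'a \<Rightarrow> 'c) set" where
  "coloring_tuples G a P = (\<Pi>\<^sub>E i\<in>{..<a}. list_colorings G (P i))"

definition used_colors :: "nat \<Rightarrow> (nat \<Rightarrow> 'a \<Rightarrow> 'c) \<Rightarrow> 'a \<Rightarrow> 'c set" where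
  "used_colors a t v = (\<lambda>i. t i v) ` {..<a}"

definition residual_lists :: "nat \<Rightarrow> (nat \<Rightarrow> 'a \<Rightarrow> 'c) \<Rightarrow> ('a \<Rightarrow> 'c set) \<Rightarrow> 'a \<Rightarrow> 'c set" where
  "residual_lists a t Q v = Q v - used_colors a t v"

lemma finite_used_colors: "finite (used_colors a t v)"
  by (simp add: used_colors_def)

lemma card_used_colors_le: "card (used_colors a t v) \<le> a"
  unfolding used_colors_def by (metis card_image_le card_lessThan finite_lessThan)

lemma finite_residual_lists: "finite (Q v) \<Longrightarrow> finite (residual_lists a t Q v)"
  by (simp add: residual_lists_def)

lemma card_residual_lists_ge: "card (Q v) - a \<le> card (residual_lists a t Q v)"
  using diff_card_le_card_Diff[OF finite_used_colors[of a t v], of "Q v"] card_used_colors_le[of a t v]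
  by (simp add: residual_lists_def)

lemma coloring_tuplesD:
  assumes "t \<in> coloring_tuples G a P" "i < a"
  shows "t i \<in> list_colorings G (P i)" and "v \<in> pverts G \<Longrightarrow> t i v \<in> P i v"
  using assms by (auto simp: coloring_tuples_def list_colorings_def PiE_def Pi_def)

lemma coloring_tuples_nonempty_iff: "coloring_tuples G a P \<noteq> {} \<longleftrightarrow> (\<forall>i<a. list_colorable G (P i))"
  by (auto simp: coloring_tuples_def PiE_eq_empty_iff list_colorable_def)

lemma list_color_function_power_le_card_coloring_tuples:
  fixes P :: "nat \<Rightarrow> 'a \<Rightarrow> nat set"
  assumes "\<And>i. i < a \<Longrightarrow> k_assignment G n (P i)"
  shows "list_color_function G n ^ a \<le> card (coloring_tuples G a P)"
proof -
  have "list_color_function G n ^ a = (\<Prod>i<a. list_color_function G n)"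
    by simp
  also have "\<dots> \<le> (\<Prod>i<a. card (list_colorings G (P i)))"
    using assms by (intro prod_mono) (simp add: list_color_function_le)
  also have "\<dots> = card (coloring_tuples G a P)"
    by (simp add: coloring_tuples_def card_PiE)
  finally show ?thesis .
qed

lemma inj_on_coloring_tuple:
  assumes t: "t \<in> coloring_tuples G a P" and v: "v \<in> pverts G"
    and disj: "disjoint_family_on (\<lambda>i. P i v) {..<a}"
  shows "inj_on (\<lambda>i. t i v) {..<a}"
proof (rule inj_onI, rule ccontr)
  fix i i' assume i: "i \<in> {..<a}" "i' \<in> {..<a}" and eq: "t i v = t i' v" and "i \<noteq> i'"
  then have "P i v \<inter> P i' v = {}"
    using disjoint_family_onD[OF disj] by blast
  with i eq show False
    using coloring_tuplesD(2)[OF t _ v] by (metis IntI empty_iff lessThan_iff)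
qed

lemma coloring_tuples_eqI:
  assumes t: "t \<in> coloring_tuples G a P" and t': "t' \<in> coloring_tuples G a P"
    and disj: "\<And>v. v \<in> pverts G \<Longrightarrow> disjoint_family_on (\<lambda>i. P i v) {..<a}"
    and used: "\<And>v. v \<in> pverts G \<Longrightarrow> used_colors a t v = used_colors a t' v"
  shows "t = t'"
proof -
  have "t i v = t' i v" if i: "i < a" and v: "v \<in> pverts G" for i v
  proof -
    have "t i v \<in> used_colors a t' v"
      using used[OF v] i by (auto simp: used_colors_def)
    then obtain i' where i': "i' < a" "t i v = t' i' v"
      by (auto simp: used_colors_def)
    then have "t i v \<in> P i v \<inter> P i' v"
      using coloring_tuplesD(2)[OF t i v] coloring_tuplesD(2)[OF t' i'(1) v] by simp
    then have "i = i'"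
      using disjoint_family_onD[OF disj[OF v], of i i'] i i'(1) by auto
    with i' show ?thesis by simp
  qed
  moreover have "t i \<in> extensional (pverts G)" "t' i \<in> extensional (pverts G)" if "i < a" for i
    using coloring_tuplesD(1)[OF t that] coloring_tuplesD(1)[OF t' that]
    by (auto simp: list_colorings_def PiE_def)
  ultimately have "t i = t' i" if "i < a" for i
    using that by (blast intro: extensionalityI)
  then show ?thesis
    using t t' unfolding coloring_tuples_def by (intro PiE_ext) auto
qed

lemma k_assignment_used_colors_Un:
  assumes t: "t \<in> coloring_tuples G a P" and A: "k_assignment G n A"
    and disj: "\<And>v. v \<in> pverts G \<Longrightarrow> disjoint_family_on (\<lambda>i. P i v) {..<a}"
    and A_disj: "\<And>i v. i < a \<Longrightarrow> v \<in> pverts G \<Longrightarrow> P i v \<inter> A v = {}"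
  shows "k_assignment G (n + a) (\<lambda>v. used_colors a t v \<union> A v)"
  unfolding k_assignment_def
proof
  fix v assume v: "v \<in> pverts G"
  have "card (used_colors a t v) = a"
    using inj_on_coloring_tuple[OF t v disj[OF v]] by (simp add: used_colors_def card_image)
  moreover have "used_colors a t v \<inter> A v = {}"
    using coloring_tuplesD(2)[OF t _ v] A_disj[OF _ v] by (fastforce simp: used_colors_def)
  ultimately show "finite (used_colors a t v \<union> A v) \<and> card (used_colors a t v \<union> A v) = n + a"
    using k_assignmentD[OF A v] by (simp add: card_Un_disjoint finite_used_colors)
qed

context pair_graph
begin

lemma finite_coloring_tuples:
  assumes "\<And>i. i < a \<Longrightarrow> k_assignment G n (P i)"
  shows "finite (coloring_tuples G a P)"
  unfolding coloring_tuples_def using assms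
  by (intro finite_PiE finite_list_colorings) (auto dest: k_assignmentD(1))

lemma pair_graph_product_complete_bipartite: "pair_graph (G \<box> complete_bipartite a b)"
  by (intro pair_graph_cartesian_product pair_graph pair_graph_complete_bipartite)

lemma list_colorable_product_complete_bipartite_iff:
  "list_colorable (G \<box> complete_bipartite a b) L \<longleftrightarrow> (\<exists>c.
    (\<forall>i<a. \<forall>v\<in>pverts G. c (v, Inl i) \<in> L (v, Inl i)) \<and> (\<forall>j<b. \<forall>v\<in>pverts G. c (v, Inr j) \<in> L (v, Inr j)) \<and>
    (\<forall>i<a. proper_coloring G (\<lambda>v. c (v, Inl i))) \<and> (\<forall>j<b. proper_coloring G (\<lambda>v. c (v, Inr j))) \<and>
    (\<forall>v\<in>pverts G. \<forall>i<a. \<forall>j<b. c (v, Inl i) \<noteq> c (v, Inr j)))"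
  unfolding pair_graph.list_colorable_iff[OF pair_graph_product_complete_bipartite]
    proper_coloring_cartesian_product_iff[OF pair_graph pair_graph_complete_bipartite]
    proper_coloring_complete_bipartite_iff ball_pverts_cartesian_product ball_pverts_complete_bipartite
  by (simp only: conj_assoc)

lemma list_colorable_product_complete_bipartite_iff_coloring_tuple:
  "list_colorable (G \<box> complete_bipartite a b) L \<longleftrightarrow>
    (\<exists>t\<in>coloring_tuples G a (\<lambda>i v. L (v, Inl i)).
      \<forall>j<b. list_colorable G (residual_lists a t (\<lambda>v. L (v, Inr j))))"
    (is "?colorable \<longleftrightarrow> ?extendable")
proof
  assume ?colorable
  then obtain c where
    left: "\<forall>i<a. (\<forall>v\<in>pverts G. c (v, Inl i) \<in> L (v, Inl i)) \<and> proper_coloring G (\<lambda>v. c (v, Inl i))" and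
    right: "\<forall>j<b. (\<forall>v\<in>pverts G. c (v, Inr j) \<in> L (v, Inr j)) \<and> proper_coloring G (\<lambda>v. c (v, Inr j))" and
    cross: "\<forall>v\<in>pverts G. \<forall>i<a. \<forall>j<b. c (v, Inl i) \<noteq> c (v, Inr j)"
    unfolding list_colorable_product_complete_bipartite_iff by blast
  define t where "t = (\<lambda>i\<in>{..<a}. \<lambda>v\<in>pverts G. c (v, Inl i))"
  have "t \<in> coloring_tuples G a (\<lambda>i v. L (v, Inl i))"
    using left by (auto simp: t_def coloring_tuples_def list_colorings_def proper_coloring_restrict)
  moreover have "c (v, Inr j) \<in> residual_lists a t (\<lambda>v. L (v, Inr j)) v"
    if "j < b" "v \<in> pverts G" for j v
    using right cross that by (force simp: t_def residual_lists_def used_colors_def)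
  then have "list_colorable G (residual_lists a t (\<lambda>v. L (v, Inr j)))" if "j < b" for j
    using right that by (intro list_colorableI[where c = "\<lambda>v. c (v, Inr j)"]) simp_all
  ultimately show ?extendable by blast
next
  assume ?extendable
  then obtain t where t: "t \<in> coloring_tuples G a (\<lambda>i v. L (v, Inl i))"
    and "\<forall>j<b. \<exists>d. (\<forall>v\<in>pverts G. d v \<in> residual_lists a t (\<lambda>v. L (v, Inr j)) v) \<and> proper_coloring G d"
    unfolding list_colorable_iff by blast
  from this(2) obtain d where
    d: "\<forall>j<b. (\<forall>v\<in>pverts G. d j v \<in> residual_lists a t (\<lambda>v. L (v, Inr j)) v) \<and> proper_coloring G (d j)"
    by metis
  define c where "c = (\<lambda>(v, x). case x of Inl i \<Rightarrow> t i v | Inr j \<Rightarrow> d j v)"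
  have "c (v, Inl i) \<in> L (v, Inl i)" if "i < a" "v \<in> pverts G" for i v
    using coloring_tuplesD(2)[OF t that] by (simp add: c_def)
  moreover have "proper_coloring G (\<lambda>v. c (v, Inl i))" if "i < a" for i
    using coloring_tuplesD(1)[OF t that] by (simp add: c_def list_colorings_def)
  ultimately show ?colorable
    using d unfolding list_colorable_product_complete_bipartite_iff
    by (intro exI[of _ c]) (force simp: c_def residual_lists_def used_colors_def)
qed

lemma less_list_chromatic_number_product_complete_bipartite_iff:
  "n < list_chromatic_number (G \<box> complete_bipartite a b) \<longleftrightarrow>
    (\<exists>P Q :: nat \<Rightarrow> 'a \<Rightarrow> nat set.
      (\<forall>i<a. k_assignment G n (P i)) \<and> (\<forall>j<b. k_assignment G n (Q j)) \<and>
      (\<forall>t\<in>coloring_tuples G a P. \<exists>j<b. \<not> list_colorable G (residual_lists a t (Q j))))"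
    (is "_ \<longleftrightarrow> (\<exists>P Q. ?bad P Q)")
proof -
  have "n < list_chromatic_number (G \<box> complete_bipartite a b) \<longleftrightarrow>
      (\<exists>L :: 'a \<times> (nat + nat) \<Rightarrow> nat set. ?bad (\<lambda>i v. L (v, Inl i)) (\<lambda>j v. L (v, Inr j)))"
    unfolding not_le[symmetric] pair_graph.list_chromatic_number_le_iff[OF pair_graph_product_complete_bipartite]
      k_assignment_product_complete_bipartite_iff list_colorable_product_complete_bipartite_iff_coloring_tuple
    by auto
  also have "\<dots> \<longleftrightarrow> (\<exists>P Q. ?bad P Q)"
  proof
    assume "\<exists>P Q. ?bad P Q"
    then obtain P Q where "?bad P Q"
      by blast
    then show "\<exists>L :: 'a \<times> (nat + nat) \<Rightarrow> nat set. ?bad (\<lambda>i v. L (v, Inl i)) (\<lambda>j v. L (v, Inr j))"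
      by (intro exI[of _ "\<lambda>(v, x). case x of Inl i \<Rightarrow> P i v | Inr j \<Rightarrow> Q j v"]) simp
  qed (elim exE, intro exI)
  finally show ?thesis .
qed

lemma list_chromatic_number_product_complete_bipartite_le:
  "list_chromatic_number (G \<box> complete_bipartite a b) \<le> list_chromatic_number G + a"
proof (rule ccontr)
  let ?n = "list_chromatic_number G"
  assume "\<not> ?thesis"
  then obtain P Q :: "nat \<Rightarrow> 'a \<Rightarrow> nat set"
    where P: "\<forall>i<a. k_assignment G (?n + a) (P i)" and Q: "\<forall>j<b. k_assignment G (?n + a) (Q j)"
      and bad: "\<forall>t\<in>coloring_tuples G a P. \<exists>j<b. \<not> list_colorable G (residual_lists a t (Q j))"
    unfolding not_le less_list_chromatic_number_product_complete_bipartite_iff by blast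
  have "\<forall>i<a. list_colorable G (P i)"
    using P by (auto simp: k_assignment_def intro: list_colorable_if_list_chromatic_number_le)
  then obtain t where "t \<in> coloring_tuples G a P"
    using coloring_tuples_nonempty_iff by blast
  with bad obtain j where j: "j < b" and uncolorable: "\<not> list_colorable G (residual_lists a t (Q j))"
    by blast
  have "list_colorable G (residual_lists a t (Q j))"
  proof (rule list_colorable_if_list_chromatic_number_le)
    fix v assume "v \<in> pverts G"
    then have "finite (Q j v)" "card (Q j v) = ?n + a"
      using Q j by (auto simp: k_assignment_def)
    then show "finite (residual_lists a t (Q j) v)" "?n \<le> card (residual_lists a t (Q j) v)"
      using card_residual_lists_ge[of "Q j" v a t] by (simp_all add: finite_residual_lists)
  qed
  with uncolorable show False by blast
qed

lemma blocking_assignments_exist: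
  fixes P :: "nat \<Rightarrow> 'a \<Rightarrow> 'c set"
  assumes P: "\<And>i. i < a \<Longrightarrow> k_assignment G m (P i)" "\<And>i. i < a \<Longrightarrow> list_colorable G (P i)"
    and disj: "\<And>v. v \<in> pverts G \<Longrightarrow> disjoint_family_on (\<lambda>i. P i v) {..<a}"
    and A: "k_assignment G n A" "\<not> list_colorable G A"
    and A_disj: "\<And>i v. i < a \<Longrightarrow> v \<in> pverts G \<Longrightarrow> P i v \<inter> A v = {}"
  obtains b :: nat and Q where "1 \<le> b" "\<forall>j<b. k_assignment G (n + a) (Q j)"
    "\<forall>t\<in>coloring_tuples G a P. \<exists>j<b. \<not> list_colorable G (residual_lists a t (Q j))"
proof -
  let ?T = "coloring_tuples G a P"
  have "finite ?T"
    using P(1) by (rule finite_coloring_tuples)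
  then obtain h where "bij_betw h {0..<card ?T} ?T"
    using ex_bij_betw_nat_finite by blast
  then have h: "h ` {..<card ?T} = ?T"
    by (simp add: bij_betw_def lessThan_atLeast0)
  define Q where "Q j v = used_colors a (h j) v \<union> A v" for j v
  have Q_blocks: "\<not> list_colorable G (residual_lists a (h j) (Q j))" for j
  proof
    assume "list_colorable G (residual_lists a (h j) (Q j))"
    then have "list_colorable G A"
      by (rule list_colorable_mono) (auto simp: residual_lists_def Q_def)
    with A(2) show False ..
  qed
  have "1 \<le> card ?T"
    using \<open>finite ?T\<close> P(2) coloring_tuples_nonempty_iff[of G a P] by (simp add: Suc_le_eq card_gt_0_iff)
  moreover have "k_assignment G (n + a) (Q j)" if "j < card ?T" for j
  proof -
    have "h j \<in> ?T"
      using h that by blast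
    then show ?thesis
      using A(1) disj A_disj unfolding Q_def by (rule k_assignment_used_colors_Un)
  qed
  moreover have "\<exists>j<card ?T. \<not> list_colorable G (residual_lists a t (Q j))" if "t \<in> ?T" for t
  proof -
    have "t \<in> h ` {..<card ?T}"
      unfolding h by (rule that)
    then obtain j where "j < card ?T" "t = h j"
      by blast
    then show ?thesis
      using Q_blocks by blast
  qed
  ultimately show thesis
    by (intro that[of "card ?T" Q]) simp_all
qed

lemma list_chromatic_number_product_complete_bipartite_attained:
  assumes "pverts G \<noteq> {}"
  obtains b where "1 \<le> b" "list_chromatic_number (G \<box> complete_bipartite a b) = list_chromatic_number G + a"
proof -
  define n where "n = list_chromatic_number G - 1"
  have n: "list_chromatic_number G = Suc n"
    using chromatic_number_pos[OF assms] chromatic_number_le_list_chromatic_number by (simp add: n_def)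
  then obtain B :: "'a \<Rightarrow> nat set" where B: "k_assignment G n B" "\<not> list_colorable G B"
    using list_chromatic_number_le_iff[of n] by auto
  define m where "m = n + a"
  define P where "P i v = {i * m..<Suc i * m}" for i and v :: 'a
  define A where "A v = (+) (a * m) ` B v" for v
  have P: "k_assignment G m (P i)" for i
    by (simp add: P_def k_assignment_def)
  have P_colorable: "list_colorable G (P i)" if "i < a" for i
    using that n by (intro list_colorable_if_list_chromatic_number_le) (auto simp: P_def m_def)
  have P_disj: "disjoint_family_on (\<lambda>i. P i v) {..<a}" for v
    unfolding P_def by (rule disjoint_family_on_mono[OF subset_UNIV disjoint_family_blocks])
  have A: "k_assignment G n A"
    using B(1) by (auto simp: A_def k_assignment_def card_image)
  have A_uncolorable: "\<not> list_colorable G A"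
    using B(2) list_colorable_imageD unfolding A_def by blast
  have P_A_disj: "P i v \<inter> A v = {}" if "i < a" for i v
    using mult_le_mono1[of "Suc i" a m] that by (auto simp: P_def A_def)
  obtain b :: nat and Q where b: "1 \<le> b" and "\<forall>j<b. k_assignment G m (Q j)"
    and "\<forall>t\<in>coloring_tuples G a P. \<exists>j<b. \<not> list_colorable G (residual_lists a t (Q j))"
    unfolding m_def
    by (rule blocking_assignments_exist[OF P P_colorable P_disj A A_uncolorable P_A_disj])
  with P have "m < list_chromatic_number (G \<box> complete_bipartite a b)"
    unfolding less_list_chromatic_number_product_complete_bipartite_iff by blast
  with b n show thesis
    using list_chromatic_number_product_complete_bipartite_le[of a b]
    by (intro that[of b]) (simp_all add: m_def)
qed

lemma list_chromatic_number_product_f_number: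
  assumes "pverts G \<noteq> {}"
  shows "list_chromatic_number (G \<box> complete_bipartite a (f_number a G)) = list_chromatic_number G + a"
proof -
  have "\<exists>b. 1 \<le> b \<and> list_chromatic_number (G \<box> complete_bipartite a b) = list_chromatic_number G + a"
    using list_chromatic_number_product_complete_bipartite_attained[OF assms] by metis
  from LeastI_ex[OF this] show ?thesis
    unfolding f_number_def by blast
qed

end

section \<open>Connected strong chromatic-choosable graphs\<close>

locale connected_strong_chromatic_choosable = pair_graph M for M :: "'a pair_pre_digraph" +
  fixes k :: nat
  assumes connected: "Digraph_Component.connected (with_proj M)"
    and strong: "strong_chromatic_choosable k M"
begin

lemma chromatic_number_eq: "chromatic_number M = k"
  using strong by (simp add: strong_chromatic_choosable_def)

lemma pverts_nonempty: "pverts M \<noteq> {}"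
  using connected by (simp add: connected_def strongly_connected_def)

lemma k_pos: "0 < k"
  using chromatic_number_pos[OF pverts_nonempty] chromatic_number_eq by simp

text \<open>Beyond nonemptiness, connectedness matters only for \<open>k = 1\<close>, where an edgeless graph on
  several vertices would be a counterexample.\<close>

lemma uncolorable_imp_constant:
  fixes L :: "'a \<Rightarrow> nat set"
  assumes fin: "\<And>v. v \<in> pverts M \<Longrightarrow> finite (L v)"
    and card_ge: "\<And>v. v \<in> pverts M \<Longrightarrow> k - 1 \<le> card (L v)"
    and uncolorable: "\<not> list_colorable M L"
  shows "k_assignment M (k - 1) L" and "constant_assignment M L"
proof -
  have "k_assignment M (k - 1) L \<and> constant_assignment M L"
  proof (cases "k = 1")
    case True
    obtain u where u: "u \<in> pverts M"
      using pverts_nonempty by blast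
    have no_arcs: "parcs M = {}"
      using True chromatic_number_eq by (intro no_arcs_if_chromatic_number_le_1) simp
    then have single: "pverts M = {u}"
      using connected_no_arcs_imp_single_vertex[OF connected _ u] by blast
    have "L u = {}"
      using uncolorable no_arcs unfolding list_colorable_iff single proper_coloring_def by auto
    with True single show ?thesis
      by (simp add: k_assignment_def constant_assignment_def)
  next
    case False
    then have "0 < k - 1" "1 < card (pverts M)"
      using k_pos chromatic_number_eq chromatic_number_le_card_verts by simp_all
    moreover have "constant_assignment M B"
      if "k_assignment M (k - 1) B" "\<And>v. v \<in> pverts M \<Longrightarrow> B v \<subseteq> L v" for B
      using strong that uncolorable list_colorable_mono[of B L]
      by (auto simp: strong_chromatic_choosable_def)
    ultimately show ?thesis
      using constant_assignment_if_subassignments_constant[of M L "k - 1"] fin card_ge by blast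
  qed
  then show "k_assignment M (k - 1) L" and "constant_assignment M L"
    by blast+
qed

lemma list_colorable_if_large_list:
  fixes L :: "'a \<Rightarrow> nat set"
  assumes "\<And>u. u \<in> pverts M \<Longrightarrow> finite (L u)" and "\<And>u. u \<in> pverts M \<Longrightarrow> k - 1 \<le> card (L u)"
    and v: "v \<in> pverts M" "k \<le> card (L v)"
  shows "list_colorable M L"
proof (rule ccontr)
  assume "\<not> list_colorable M L"
  with assms(1,2) have "k_assignment M (k - 1) L"
    by (rule uncolorable_imp_constant(1))
  then have "card (L v) = k - 1"
    using v(1) by (rule k_assignmentD(2))
  with v(2) k_pos show False by simp
qed

lemma list_chromatic_number_eq: "list_chromatic_number M = k"
proof (rule antisym)
  obtain v where "v \<in> pverts M"
    using pverts_nonempty by blast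
  then show "list_chromatic_number M \<le> k"
    unfolding list_chromatic_number_le_iff
    by (auto simp: k_assignment_def intro!: list_colorable_if_large_list[of _ v])
qed (use chromatic_number_le_list_chromatic_number chromatic_number_eq in simp)

lemma list_coloring_with_prescribed_color:
  fixes L :: "'a \<Rightarrow> nat set"
  assumes fin: "\<And>u. u \<in> pverts M \<Longrightarrow> finite (L u)" and card_ge: "\<And>u. u \<in> pverts M \<Longrightarrow> k \<le> card (L u)"
    and v: "v \<in> pverts M" and x: "x \<in> L v"
  shows "\<exists>c\<in>list_colorings M L. c v = x"
proof -
  have "k - 1 \<le> card (L u - {x})" if "u \<in> pverts M" for u
    using card_ge[OF that] diff_card_le_card_Diff[of "{x}" "L u"] by simp
  then have "list_colorable M ((\<lambda>u. L u - {x})(v := {..<k}))"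
    using fin v by (intro list_colorable_if_large_list[of _ v]) auto
  with v x show ?thesis
    by (rule list_coloring_by_recoloring)
qed

lemma coloring_tuple_with_prescribed_colors:
  fixes P :: "nat \<Rightarrow> 'a \<Rightarrow> nat set"
  assumes P: "\<And>i. i < a \<Longrightarrow> k_assignment M n (P i)" and "k \<le> n"
    and v: "v \<in> pverts M" and y: "\<And>i. i < a \<Longrightarrow> y i \<in> P i v"
  shows "\<exists>t\<in>coloring_tuples M a P. \<forall>i<a. t i v = y i"
proof -
  have "\<exists>c\<in>list_colorings M (P i). c v = y i" if i: "i < a" for i
  proof -
    have "finite (P i u)" "k \<le> card (P i u)" if "u \<in> pverts M" for u
      using k_assignmentD[OF P[OF i] that] \<open>k \<le> n\<close> by simp_all
    then show ?thesis
      using v y[OF i] by (rule list_coloring_with_prescribed_color)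
  qed
  then obtain c where "\<forall>i<a. c i \<in> list_colorings M (P i) \<and> c i v = y i"
    by metis
  then show ?thesis
    by (intro bexI[of _ "restrict c {..<a}"]) (auto simp: coloring_tuples_def)
qed

end

section \<open>Counting blocked tuples of colorings\<close>

text \<open>\<open>P i\<close> and \<open>Q j\<close> are the lists on the copies of \<open>M\<close> over the vertices \<open>Inl i\<close> and \<open>Inr j\<close> of
  \<open>K\<^bsub>a,b\<^esub>\<close>.\<close>

locale blocking_assignments = connected_strong_chromatic_choosable M k
  for M :: "'a pair_pre_digraph" and k :: nat +
  fixes a b :: nat and P Q :: "nat \<Rightarrow> 'a \<Rightarrow> nat set"
  assumes P: "i < a \<Longrightarrow> k_assignment M (k + a - 1) (P i)"
    and Q: "j < b \<Longrightarrow> k_assignment M (k + a - 1) (Q j)"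
    and blocking: "t \<in> coloring_tuples M a P \<Longrightarrow> \<exists>j<b. \<not> list_colorable M (residual_lists a t (Q j))"
begin

definition blocked_tuples :: "nat \<Rightarrow> (nat \<Rightarrow> 'a \<Rightarrow> nat) set" where
  "blocked_tuples j = {t \<in> coloring_tuples M a P. \<not> list_colorable M (residual_lists a t (Q j))}"

lemma coloring_tuples_eq_UN_blocked_tuples: "coloring_tuples M a P = (\<Union>j<b. blocked_tuples j)"
  using blocking by (auto simp: blocked_tuples_def)

lemma blocked_residual_lists:
  assumes t: "t \<in> blocked_tuples j" and j: "j < b"
  shows "k_assignment M (k - 1) (residual_lists a t (Q j))"
    and "constant_assignment M (residual_lists a t (Q j))"
proof -
  have "finite (residual_lists a t (Q j) v)" "k - 1 \<le> card (residual_lists a t (Q j) v)"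
    if "v \<in> pverts M" for v
    using card_residual_lists_ge[of "Q j" v a t] k_assignmentD[OF Q[OF j] that]
    by (auto intro: finite_residual_lists)
  then show "k_assignment M (k - 1) (residual_lists a t (Q j))"
    and "constant_assignment M (residual_lists a t (Q j))"
    using t uncolorable_imp_constant[of "residual_lists a t (Q j)"] by (auto simp: blocked_tuples_def)
qed

lemma
  assumes t: "t \<in> blocked_tuples j" and j: "j < b" and v: "v \<in> pverts M"
  shows inj_on_blocked_tuple: "inj_on (\<lambda>i. t i v) {..<a}"
    and used_colors_blocked_tuple_subset: "used_colors a t v \<subseteq> Q j v"
proof -
  have "card (residual_lists a t (Q j) v) + a = k + a - 1"
    using k_assignmentD(2)[OF blocked_residual_lists(1)[OF t j] v] k_pos by simp
  with k_assignmentD[OF Q[OF j] v] show "inj_on (\<lambda>i. t i v) {..<a}" and "used_colors a t v \<subseteq> Q j v"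
    using inj_on_and_image_subset_if_card_Diff_le[of "Q j v" "{..<a}" "\<lambda>i. t i v"]
    by (simp_all add: residual_lists_def used_colors_def)
qed

text \<open>A color common to two of the lists \<open>P i v\<close> could be used twice at \<open>v\<close>, and then no \<open>Q j\<close>
  would block the tuple.\<close>

lemma disjoint_family_on_P:
  assumes v: "v \<in> pverts M"
  shows "disjoint_family_on (\<lambda>i. P i v) {..<a}"
  unfolding disjoint_family_on_def
proof (intro ballI impI equals0I)
  fix i i' x assume i: "i \<in> {..<a}" "i' \<in> {..<a}" "i \<noteq> i'" and x: "x \<in> P i v \<inter> P i' v"
  have "P l v \<noteq> {}" if "l < a" for l
    using k_assignmentD(2)[OF P[OF that] v] k_pos that by force
  then have "\<forall>l<a. \<exists>y. y \<in> P l v \<and> (x \<in> P l v \<longrightarrow> y = x)"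
    by blast
  then obtain y where y: "\<forall>l<a. y l \<in> P l v \<and> (x \<in> P l v \<longrightarrow> y l = x)"
    by metis
  have "k \<le> k + a - 1"
    using i(1) by auto
  with P have "\<exists>t\<in>coloring_tuples M a P. \<forall>l<a. t l v = y l"
    using v by (rule coloring_tuple_with_prescribed_colors) (use y in simp_all)
  then obtain t where t: "t \<in> coloring_tuples M a P" "\<forall>l<a. t l v = y l"
    by blast
  then obtain j where "j < b" "t \<in> blocked_tuples j"
    using coloring_tuples_eq_UN_blocked_tuples by blast
  then have "inj_on (\<lambda>i. t i v) {..<a}"
    using inj_on_blocked_tuple v by blast
  moreover have "t i v = t i' v"
    using t(2) y i x by simp
  ultimately show False
    using i by (auto dest: inj_onD)
qed

text \<open>The colors at \<open>w\<close> determine the common residual list, hence the set of colors that are used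
  at any other vertex \<open>v\<close>, which is the rest of the list \<open>Q j v\<close>.\<close>

lemma blocked_tuples_eqI:
  assumes j: "j < b" and t: "t \<in> blocked_tuples j" and t': "t' \<in> blocked_tuples j"
    and w: "w \<in> pverts M" and at_w: "used_colors a t w = used_colors a t' w"
  shows "t = t'"
proof (rule coloring_tuples_eqI)
  show "t \<in> coloring_tuples M a P" "t' \<in> coloring_tuples M a P"
    using t t' by (simp_all add: blocked_tuples_def)
next
  fix v assume v: "v \<in> pverts M"
  show "disjoint_family_on (\<lambda>i. P i v) {..<a}"
    using v by (rule disjoint_family_on_P)
  have "residual_lists a t (Q j) v = residual_lists a t (Q j) w"
    and "residual_lists a t' (Q j) v = residual_lists a t' (Q j) w"
    using blocked_residual_lists(2)[OF t j] blocked_residual_lists(2)[OF t' j] v w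
    unfolding constant_assignment_def by blast+
  with at_w have "Q j v - used_colors a t v = Q j v - used_colors a t' v"
    by (simp add: residual_lists_def)
  then show "used_colors a t v = used_colors a t' v"
    using used_colors_blocked_tuple_subset[OF t j v] used_colors_blocked_tuple_subset[OF t' j v] by blast
qed

lemma card_blocked_tuples_le:
  assumes j: "j < b"
  shows "card (blocked_tuples j) \<le> 2 ^ (k - 1)"
proof -
  obtain w where w: "w \<in> pverts M"
    using pverts_nonempty by blast
  define S where "S i = Q j w \<inter> P i w" for i
  define colors_at_w where "colors_at_w t = (\<lambda>i\<in>{..<a}. t i w)" for t :: "nat \<Rightarrow> 'a \<Rightarrow> nat"
  have finite_S: "finite (S i)" for i
    using k_assignmentD(1)[OF Q[OF j] w] by (simp add: S_def)
  have disjoint_S: "disjoint_family_on S {..<a}"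
    using disjoint_family_on_P[OF w] by (fastforce simp: disjoint_family_on_def S_def)
  have "used_colors a t w = colors_at_w t ` {..<a}" for t
    by (simp add: used_colors_def colors_at_w_def)
  then have inj: "inj_on colors_at_w (blocked_tuples j)"
    using blocked_tuples_eqI[OF j _ _ w] by (intro inj_onI) metis
  have colors_in: "colors_at_w t \<in> (\<Pi>\<^sub>E i\<in>{..<a}. S i)" if t: "t \<in> blocked_tuples j" for t
    using used_colors_blocked_tuple_subset[OF t j w] t coloring_tuplesD(2)[of t M a P] w
    by (auto simp: colors_at_w_def S_def used_colors_def blocked_tuples_def)
  have "card (blocked_tuples j) \<le> card (\<Pi>\<^sub>E i\<in>{..<a}. S i)"
    using inj colors_in finite_S by (intro card_inj_on_le) (auto intro: finite_PiE)
  also have "\<dots> \<le> 2 ^ (card (\<Union>i<a. S i) - a)"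
    using card_PiE_le_two_power[of "{..<a}" S] disjoint_S finite_S by simp
  also have "card (\<Union>i<a. S i) \<le> card (Q j w)"
    using k_assignmentD(1)[OF Q[OF j] w] by (intro card_mono) (auto simp: S_def)
  then have "(2 :: nat) ^ (card (\<Union>i<a. S i) - a) \<le> 2 ^ (k - 1)"
    using k_assignmentD(2)[OF Q[OF j] w] by (intro power_increasing) auto
  finally show ?thesis .
qed

lemma list_color_function_power_le: "list_color_function M (k + a - 1) ^ a \<le> b * 2 ^ (k - 1)"
proof -
  have "list_color_function M (k + a - 1) ^ a \<le> card (coloring_tuples M a P)"
    using P by (rule list_color_function_power_le_card_coloring_tuples)
  also have "\<dots> = card (\<Union>j<b. blocked_tuples j)"
    by (simp only: coloring_tuples_eq_UN_blocked_tuples)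
  also have "\<dots> \<le> (\<Sum>j<b. card (blocked_tuples j))"
    by (rule card_UN_le) simp
  also have "\<dots> \<le> b * 2 ^ (k - 1)"
    using sum_bounded_above[of "{..<b}" "\<lambda>j. card (blocked_tuples j)" "2 ^ (k - 1)"]
      card_blocked_tuples_le by simp
  finally show ?thesis .
qed

end

theorem theorem1p12:
  fixes a k :: nat and M :: "'a pair_pre_digraph"
  assumes "a \<ge> 1" and "k \<ge> 1"
    and "pair_graph M"
    and "Digraph_Component.connected (with_proj M)"
    and "strong_chromatic_choosable k M"
  shows "real (list_color_function M (k + a - 1)) ^ a / 2 ^ (k - 1) \<le> real (f_number a M)"
proof -
  interpret connected_strong_chromatic_choosable M k
    using assms by (intro connected_strong_chromatic_choosable.intro
        connected_strong_chromatic_choosable_axioms.intro)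
  have "list_chromatic_number (M \<box> complete_bipartite a (f_number a M)) = k + a"
    by (simp add: list_chromatic_number_product_f_number pverts_nonempty list_chromatic_number_eq)
  then have "k + a - 1 < list_chromatic_number (M \<box> complete_bipartite a (f_number a M))"
    using k_pos by simp
  then obtain P Q where "blocking_assignments_axioms M k a (f_number a M) P Q"
    unfolding less_list_chromatic_number_product_complete_bipartite_iff blocking_assignments_axioms_def
    by blast
  then interpret blocking_assignments M k a "f_number a M" P Q
    by (rule blocking_assignments.intro[OF connected_strong_chromatic_choosable_axioms])
  have "real (list_color_function M (k + a - 1) ^ a) \<le> real (f_number a M * 2 ^ (k - 1))"
    using list_color_function_power_le by (simp only: of_nat_le_iff)
  then show ?thesis
    by (simp add: divide_le_eq)
qed

end
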